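(* Let $A$ be a differential ring. 1) Let $\theta,a,b\in A$ be such that $\theta\cdot(a'b-ab')=0$. Then for all integers $N\geq 3$ and all $0\leq i\leq N$ one has $$\theta\cdot(a'b-ab')=0,\qquad \theta^2\cdot(a''b-ab'')=0,\qquad b^{N-1}\theta^N\cdot\left(b^{(i)}a^{(N-i)}-a^{(i)}b^{(N-i)}\right)=0.$$ 2) In particular, let $S$ be a multiplicative subset of $A$, $a\in A$, $s\in S$ and $i\in\mathbf{N}$. If $\left(\frac{a}{s}\right)'=0$ in $S^{-1}A$ and $s^{(i)}\in S$, then $$\frac{a}{s}=\frac{a^{(i)}}{s^{(i)}}\quad\text{in } S^{-1}A.$$
   Context: A differential ring is a commutative ring with unit $A$ equipped with a derivation $a\mapsto a'$ (additive and satisfying $(ab)'=a'b+ab'$); $a^{(i)}$ denotes the $i$-th iterated derivative, with $a^{(0)}=a$. The localization $S^{-1}A$ carries the unique derivation extending that of $A$, given by $\left(\frac{a}{s}\right)'=\frac{a's-as'}{s^2}$. *)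

theory Defs
  imports "HOL-Algebra.Ring"
begin

locale differential_ring = cring R for R (structure) +
  fixes D :: "'a \<Rightarrow> 'a"
  assumes deriv_closed [simp, intro]: "a \<in> carrier R \<Longrightarrow> D a \<in> carrier R"
    and deriv_add: "\<lbrakk>a \<in> carrier R; b \<in> carrier R\<rbrakk> \<Longrightarrow> D (a \<oplus> b) = D a \<oplus> D b"
    and deriv_mult: "\<lbrakk>a \<in> carrier R; b \<in> carrier R\<rbrakk> \<Longrightarrow> D (a \<otimes> b) = D a \<otimes> b \<oplus> a \<otimes> D b"

text \<open>
  The localization of \<open>R\<close> at a multiplicative subset \<open>S\<close> (a \<open>submonoid\<close> of the multiplicative
  structure, so it contains \<open>\<one>\<close> and is allowed to contain zero divisors and even \<open>\<zero>\<close>) is realised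
  by equivalence classes of pairs (numerator, denominator).
\<close>

definition loc_rel :: "('a, 'm) ring_scheme \<Rightarrow> 'a set \<Rightarrow> (('a \<times> 'a) \<times> ('a \<times> 'a)) set" where
  "loc_rel R S = {((a, s), (b, t)). a \<in> carrier R \<and> s \<in> S \<and> b \<in> carrier R \<and> t \<in> S \<and>
     (\<exists>u\<in>S. u \<otimes>\<^bsub>R\<^esub> (a \<otimes>\<^bsub>R\<^esub> t \<ominus>\<^bsub>R\<^esub> b \<otimes>\<^bsub>R\<^esub> s) = \<zero>\<^bsub>R\<^esub>)}"

definition loc_frac :: "('a, 'm) ring_scheme \<Rightarrow> 'a set \<Rightarrow> 'a \<Rightarrow> 'a \<Rightarrow> ('a \<times> 'a) set" where
  "loc_frac R S a s = loc_rel R S `` {(a, s)}"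

definition localization :: "('a, 'm) ring_scheme \<Rightarrow> 'a set \<Rightarrow> ('a \<times> 'a) set ring" where
  "localization R S =
    \<lparr>carrier = (carrier R \<times> S) // loc_rel R S,
     mult = (\<lambda>X Y. \<Union>(a, s)\<in>X. \<Union>(b, t)\<in>Y. loc_frac R S (a \<otimes>\<^bsub>R\<^esub> b) (s \<otimes>\<^bsub>R\<^esub> t)),
     one = loc_frac R S \<one>\<^bsub>R\<^esub> \<one>\<^bsub>R\<^esub>,
     zero = loc_frac R S \<zero>\<^bsub>R\<^esub> \<one>\<^bsub>R\<^esub>,
     add = (\<lambda>X Y. \<Union>(a, s)\<in>X. \<Union>(b, t)\<in>Y.
              loc_frac R S (a \<otimes>\<^bsub>R\<^esub> t \<oplus>\<^bsub>R\<^esub> b \<otimes>\<^bsub>R\<^esub> s) (s \<otimes>\<^bsub>R\<^esub> t))\<rparr>"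

definition loc_deriv ::
  "('a, 'm) ring_scheme \<Rightarrow> ('a \<Rightarrow> 'a) \<Rightarrow> 'a set \<Rightarrow> ('a \<times> 'a) set \<Rightarrow> ('a \<times> 'a) set" where
  "loc_deriv R D S X =
     (\<Union>(a, s)\<in>X. loc_frac R S (D a \<otimes>\<^bsub>R\<^esub> s \<ominus>\<^bsub>R\<^esub> a \<otimes>\<^bsub>R\<^esub> D s) (s \<otimes>\<^bsub>R\<^esub> s))"

text \<open>
  The unions over representatives are independent of the representatives: see
  \<open>mult_localization\<close>, \<open>add_localization\<close> and \<open>loc_deriv_frac\<close> below.  The localization is a
  commutative ring, and \<open>loc_deriv\<close> is the unique derivation on it that extends \<open>D\<close>
  (\<open>differential_ring_localization\<close>, \<open>loc_deriv_extends\<close>, \<open>loc_deriv_unique\<close>).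
\<close>

text \<open>Reduction of identities involving differences to identities between sums of monomials.\<close>

context cring
begin

lemma diff_zero_iff:
  assumes "a \<in> carrier R" "b \<in> carrier R"
  shows "a \<ominus> b = \<zero> \<longleftrightarrow> a = b"
proof
  assume "a \<ominus> b = \<zero>"
  moreover have "a = (a \<ominus> b) \<oplus> b" using assms by (simp add: minus_eq a_assoc l_neg)
  ultimately show "a = b" using assms by simp
qed (use assms in \<open>simp add: minus_eq r_neg\<close>)

lemma mult_diff_zero_iff:
  assumes "u \<in> carrier R" "a \<in> carrier R" "b \<in> carrier R"
  shows "u \<otimes> (a \<ominus> b) = \<zero> \<longleftrightarrow> u \<otimes> a = u \<otimes> b"
  using assms diff_zero_iff[of "u \<otimes> a" "u \<otimes> b"] by (simp add: minus_eq r_distr r_minus)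

lemma diff_eq_diffI:
  assumes "a \<oplus> d = c \<oplus> b" "a \<in> carrier R" "b \<in> carrier R" "c \<in> carrier R" "d \<in> carrier R"
  shows "a \<ominus> b = c \<ominus> d"
proof -
  have "a \<ominus> b = ((a \<oplus> d) \<oplus> \<ominus> d) \<oplus> \<ominus> b"
    using assms(2-) by (simp add: minus_eq a_assoc r_neg)
  also have "\<dots> = (c \<oplus> (b \<oplus> (\<ominus> b \<oplus> \<ominus> d)))"
    using assms(2-) by (simp add: assms(1) a_ac)
  also have "b \<oplus> (\<ominus> b \<oplus> \<ominus> d) = \<ominus> d"
    using assms(2-) by (simp add: a_assoc[symmetric] r_neg)
  finally show ?thesis by (simp add: minus_eq)
qed

lemma diff_distribs:
  assumes "a \<in> carrier R" "b \<in> carrier R" "c \<in> carrier R"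
  shows "(a \<ominus> b) \<otimes> c = a \<otimes> c \<ominus> b \<otimes> c" "c \<otimes> (a \<ominus> b) = c \<otimes> a \<ominus> c \<otimes> b"
  using assms by (simp_all add: minus_eq l_distr r_distr l_minus r_minus)

lemma diff_add_diff:
  assumes "a \<in> carrier R" "b \<in> carrier R" "c \<in> carrier R" "d \<in> carrier R"
  shows "(a \<ominus> b) \<oplus> (c \<ominus> d) = (a \<oplus> c) \<ominus> (b \<oplus> d)"
  using assms by (simp add: minus_eq minus_add[symmetric] a_ac)

lemmas distribs_ac = l_distr r_distr m_ac a_ac

end

locale ring_with_mult_set = cring R for R (structure) +
  fixes S
  assumes mult_set: "submonoid S R"
begin

lemma S_carrier [simp, intro]: "s \<in> S \<Longrightarrow> s \<in> carrier R"
  using mult_set by (auto simp: submonoid_def)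

lemma S_mult [simp, intro]: "s \<in> S \<Longrightarrow> t \<in> S \<Longrightarrow> s \<otimes> t \<in> S"
  using mult_set by (auto simp: submonoid_def)

lemma S_one [simp, intro]: "\<one> \<in> S"
  using mult_set by (auto simp: submonoid_def)

lemma loc_rel_iff:
  "((a, s), (b, t)) \<in> loc_rel R S \<longleftrightarrow> a \<in> carrier R \<and> s \<in> S \<and> b \<in> carrier R \<and> t \<in> S \<and>
     (\<exists>u\<in>S. u \<otimes> (a \<otimes> t) = u \<otimes> (b \<otimes> s))"
  by (auto simp: loc_rel_def mult_diff_zero_iff)

lemma equiv_loc_rel: "equiv (carrier R \<times> S) (loc_rel R S)"
proof (rule equivI)
  show "loc_rel R S \<subseteq> (carrier R \<times> S) \<times> (carrier R \<times> S)"
    by (auto simp: loc_rel_def)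
  show "refl_on (carrier R \<times> S) (loc_rel R S)"
  proof (rule refl_onI)
    fix x assume "x \<in> carrier R \<times> S"
    then obtain a s where x: "x = (a, s)" "a \<in> carrier R" "s \<in> S" by auto
    then show "(x, x) \<in> loc_rel R S"
      using x by (auto simp: loc_rel_iff)
  qed
  show "sym (loc_rel R S)"
  proof (rule symI, clarify)
    fix a s b t assume "((a, s), (b, t)) \<in> loc_rel R S"
    then obtain u where u: "a \<in> carrier R" "s \<in> S" "b \<in> carrier R" "t \<in> S" "u \<in> S"
      "u \<otimes> (a \<otimes> t) = u \<otimes> (b \<otimes> s)"
      by (auto simp: loc_rel_iff)
    then show "((b, t), (a, s)) \<in> loc_rel R S"
      using u(1-5) u(6)[symmetric] by (auto simp: loc_rel_iff)
  qed
  show "trans (loc_rel R S)"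
  proof (rule transI, clarify)
    fix a s b t c r
    assume "((a, s), (b, t)) \<in> loc_rel R S" "((b, t), (c, r)) \<in> loc_rel R S"
    then obtain u v where u: "a \<in> carrier R" "s \<in> S" "b \<in> carrier R" "t \<in> S" "u \<in> S"
      "c \<in> carrier R" "r \<in> S" "v \<in> S"
      "u \<otimes> (a \<otimes> t) = u \<otimes> (b \<otimes> s)" "v \<otimes> (b \<otimes> r) = v \<otimes> (c \<otimes> t)"
      by (auto simp: loc_rel_iff)
    have c: "s \<in> carrier R" "t \<in> carrier R" "u \<in> carrier R" "v \<in> carrier R" "r \<in> carrier R"
      using u by auto
    have "(u \<otimes> v \<otimes> t) \<otimes> (a \<otimes> r) = v \<otimes> r \<otimes> (u \<otimes> (a \<otimes> t))"
      using u(1,3,6) c by (simp add: m_ac)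
    also have "\<dots> = u \<otimes> s \<otimes> (v \<otimes> (b \<otimes> r))"
      unfolding u(9) using u(1,3,6) c by (simp add: m_ac)
    also have "\<dots> = (u \<otimes> v \<otimes> t) \<otimes> (c \<otimes> s)"
      unfolding u(10) using u(1,3,6) c by (simp add: m_ac)
    finally show "((a, s), (c, r)) \<in> loc_rel R S"
      using u by (auto simp: loc_rel_iff intro!: bexI[of _ "u \<otimes> v \<otimes> t"])
  qed
qed

lemma loc_frac_eq_iff:
  assumes "a \<in> carrier R" "s \<in> S" "b \<in> carrier R" "t \<in> S"
  shows "loc_frac R S a s = loc_frac R S b t \<longleftrightarrow> (\<exists>u\<in>S. u \<otimes> (a \<otimes> t) = u \<otimes> (b \<otimes> s))"
  using assms eq_equiv_class_iff[OF equiv_loc_rel, of "(a, s)" "(b, t)"]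
  by (simp add: loc_frac_def loc_rel_iff)

lemma loc_frac_eqI:
  assumes "u \<otimes> (a \<otimes> t) = u \<otimes> (b \<otimes> s)" "a \<in> carrier R" "s \<in> S" "b \<in> carrier R" "t \<in> S" "u \<in> S"
  shows "loc_frac R S a s = loc_frac R S b t"
  using assms by (subst loc_frac_eq_iff) auto

lemma carrier_localization:
  "carrier (localization R S) = {loc_frac R S a s | a s. a \<in> carrier R \<and> s \<in> S}"
  by (auto simp: localization_def quotient_def loc_frac_def)

lemma loc_frac_closed [simp, intro]:
  "a \<in> carrier R \<Longrightarrow> s \<in> S \<Longrightarrow> loc_frac R S a s \<in> carrier (localization R S)"
  by (auto simp: carrier_localization)

lemma one_localization: "\<one>\<^bsub>localization R S\<^esub> = loc_frac R S \<one> \<one>"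
  and zero_localization: "\<zero>\<^bsub>localization R S\<^esub> = loc_frac R S \<zero> \<one>"
  by (simp_all add: localization_def)

lemma mult_localization:
  assumes "a \<in> carrier R" "s \<in> S" "b \<in> carrier R" "t \<in> S"
  shows "loc_frac R S a s \<otimes>\<^bsub>localization R S\<^esub> loc_frac R S b t = loc_frac R S (a \<otimes> b) (s \<otimes> t)"
proof -
  have "(\<lambda>x y. (\<lambda>(a, s). \<lambda>(b, t). loc_frac R S (a \<otimes> b) (s \<otimes> t)) x y)
      respects2 loc_rel R S"
  proof (rule congruent2I'; clarify)
    fix a s a' s' b t b' t'
    assume "((a, s), (a', s')) \<in> loc_rel R S" "((b, t), (b', t')) \<in> loc_rel R S"
    then obtain u v where u: "a \<in> carrier R" "s \<in> S" "a' \<in> carrier R" "s' \<in> S"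
      "b \<in> carrier R" "t \<in> S" "b' \<in> carrier R" "t' \<in> S" "u \<in> S" "v \<in> S"
      "u \<otimes> (a \<otimes> s') = u \<otimes> (a' \<otimes> s)" "v \<otimes> (b \<otimes> t') = v \<otimes> (b' \<otimes> t)"
      by (auto simp: loc_rel_iff)
    have c: "s \<in> carrier R" "s' \<in> carrier R" "t \<in> carrier R" "t' \<in> carrier R"
      "u \<in> carrier R" "v \<in> carrier R" using u by auto
    have "(u \<otimes> v) \<otimes> ((a \<otimes> b) \<otimes> (s' \<otimes> t')) = (u \<otimes> (a \<otimes> s')) \<otimes> (v \<otimes> (b \<otimes> t'))"
      using u(1,3,5,7) c by (simp add: m_ac)
    also have "\<dots> = (u \<otimes> v) \<otimes> ((a' \<otimes> b') \<otimes> (s \<otimes> t))"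
      unfolding u(11,12) using u(1,3,5,7) c by (simp add: m_ac)
    finally show "loc_frac R S (a \<otimes> b) (s \<otimes> t) = loc_frac R S (a' \<otimes> b') (s' \<otimes> t')"
      using u by (intro loc_frac_eqI[where u = "u \<otimes> v"]) auto
  qed
  from UN_equiv_class2[OF equiv_loc_rel equiv_loc_rel this, of "(a, s)" "(b, t)"] assms
  show ?thesis by (simp add: localization_def loc_frac_def case_prod_unfold)
qed

lemma add_localization:
  assumes "a \<in> carrier R" "s \<in> S" "b \<in> carrier R" "t \<in> S"
  shows "loc_frac R S a s \<oplus>\<^bsub>localization R S\<^esub> loc_frac R S b t =
    loc_frac R S (a \<otimes> t \<oplus> b \<otimes> s) (s \<otimes> t)"
proof -
  have "(\<lambda>x y. (\<lambda>(a, s). \<lambda>(b, t). loc_frac R S (a \<otimes> t \<oplus> b \<otimes> s) (s \<otimes> t)) x y)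
      respects2 loc_rel R S"
  proof (rule congruent2I'; clarify)
    fix a s a' s' b t b' t'
    assume "((a, s), (a', s')) \<in> loc_rel R S" "((b, t), (b', t')) \<in> loc_rel R S"
    then obtain u v where u: "a \<in> carrier R" "s \<in> S" "a' \<in> carrier R" "s' \<in> S"
      "b \<in> carrier R" "t \<in> S" "b' \<in> carrier R" "t' \<in> S" "u \<in> S" "v \<in> S"
      "u \<otimes> (a \<otimes> s') = u \<otimes> (a' \<otimes> s)" "v \<otimes> (b \<otimes> t') = v \<otimes> (b' \<otimes> t)"
      by (auto simp: loc_rel_iff)
    have c: "s \<in> carrier R" "s' \<in> carrier R" "t \<in> carrier R" "t' \<in> carrier R"
      "u \<in> carrier R" "v \<in> carrier R" using u by auto
    have "(u \<otimes> v) \<otimes> ((a \<otimes> t \<oplus> b \<otimes> s) \<otimes> (s' \<otimes> t')) =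
      v \<otimes> t \<otimes> t' \<otimes> (u \<otimes> (a \<otimes> s')) \<oplus> u \<otimes> s \<otimes> s' \<otimes> (v \<otimes> (b \<otimes> t'))"
      using u(1,3,5,7) c by (simp add: distribs_ac)
    also have "\<dots> = (u \<otimes> v) \<otimes> ((a' \<otimes> t' \<oplus> b' \<otimes> s') \<otimes> (s \<otimes> t))"
      unfolding u(11,12) using u(1,3,5,7) c by (simp add: distribs_ac)
    finally show "loc_frac R S (a \<otimes> t \<oplus> b \<otimes> s) (s \<otimes> t) = loc_frac R S (a' \<otimes> t' \<oplus> b' \<otimes> s') (s' \<otimes> t')"
      using u by (intro loc_frac_eqI[where u = "u \<otimes> v"]) auto
  qed
  from UN_equiv_class2[OF equiv_loc_rel equiv_loc_rel this, of "(a, s)" "(b, t)"] assms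
  show ?thesis by (simp add: localization_def loc_frac_def case_prod_unfold)
qed

lemma loc_frac_eqI':
  assumes "a \<otimes> t = b \<otimes> s" "a \<in> carrier R" "s \<in> S" "b \<in> carrier R" "t \<in> S"
  shows "loc_frac R S a s = loc_frac R S b t"
  using assms by (intro loc_frac_eqI[where u = \<one>]) auto

theorem cring_localization: "cring (localization R S)"
proof (rule cringI)
  let ?L = "localization R S"
  note ops = mult_localization add_localization one_localization zero_localization
  show "abelian_group ?L"
  proof (rule abelian_groupI)
    fix x y assume "x \<in> carrier ?L" "y \<in> carrier ?L"
    then show "x \<oplus>\<^bsub>?L\<^esub> y \<in> carrier ?L"
      by (auto simp: carrier_localization ops) (metis S_carrier S_mult add.m_closed m_closed)
  next
    show "\<zero>\<^bsub>?L\<^esub> \<in> carrier ?L" by (auto simp: ops)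
  next
    fix x y z assume "x \<in> carrier ?L" "y \<in> carrier ?L" "z \<in> carrier ?L"
    then obtain a s b t c r where xyz: "x = loc_frac R S a s" "y = loc_frac R S b t" "z = loc_frac R S c r"
      and S: "s \<in> S" "t \<in> S" "r \<in> S" and C: "a \<in> carrier R" "b \<in> carrier R" "c \<in> carrier R"
      by (auto simp: carrier_localization)
    have C': "s \<in> carrier R" "t \<in> carrier R" "r \<in> carrier R" using S by auto
    have "((a \<otimes> t \<oplus> b \<otimes> s) \<otimes> r \<oplus> c \<otimes> (s \<otimes> t)) \<otimes> (s \<otimes> (t \<otimes> r)) =
      (a \<otimes> (t \<otimes> r) \<oplus> (b \<otimes> r \<oplus> c \<otimes> t) \<otimes> s) \<otimes> (s \<otimes> t \<otimes> r)"
      using C C' by (simp add: distribs_ac)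
    then show "x \<oplus>\<^bsub>?L\<^esub> y \<oplus>\<^bsub>?L\<^esub> z = x \<oplus>\<^bsub>?L\<^esub> (y \<oplus>\<^bsub>?L\<^esub> z)"
      using S C by (simp add: xyz ops) (rule loc_frac_eqI', simp+)
  next
    fix x y assume "x \<in> carrier ?L" "y \<in> carrier ?L"
    then obtain a s b t where xy: "x = loc_frac R S a s" "y = loc_frac R S b t"
      and S: "s \<in> S" "t \<in> S" and C: "a \<in> carrier R" "b \<in> carrier R"
      by (auto simp: carrier_localization)
    have C': "s \<in> carrier R" "t \<in> carrier R" using S by auto
    have "(a \<otimes> t \<oplus> b \<otimes> s) \<otimes> (t \<otimes> s) = (b \<otimes> s \<oplus> a \<otimes> t) \<otimes> (s \<otimes> t)"
      using C C' by (simp add: distribs_ac)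
    then show "x \<oplus>\<^bsub>?L\<^esub> y = y \<oplus>\<^bsub>?L\<^esub> x"
      using S C by (simp add: xy ops) (rule loc_frac_eqI', simp+)
  next
    fix x assume "x \<in> carrier ?L"
    then obtain a s where x: "x = loc_frac R S a s" and S: "s \<in> S" and C: "a \<in> carrier R"
      by (auto simp: carrier_localization)
    show "\<zero>\<^bsub>?L\<^esub> \<oplus>\<^bsub>?L\<^esub> x = x"
      using S C by (auto simp: x ops)
    have "(\<ominus> a \<otimes> s \<oplus> a \<otimes> s) \<otimes> \<one> = \<zero> \<otimes> (s \<otimes> s)"
      using C S_carrier[OF S] by (simp add: l_minus l_neg)
    then have "loc_frac R S (\<ominus> a) s \<oplus>\<^bsub>?L\<^esub> x = \<zero>\<^bsub>?L\<^esub>"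
      using S C by (simp add: x ops) (rule loc_frac_eqI', simp+)
    then show "\<exists>y\<in>carrier ?L. y \<oplus>\<^bsub>?L\<^esub> x = \<zero>\<^bsub>?L\<^esub>"
      using S C by auto
  qed
  show "comm_monoid ?L"
  proof (rule comm_monoidI)
    fix x y assume "x \<in> carrier ?L" "y \<in> carrier ?L"
    then show "x \<otimes>\<^bsub>?L\<^esub> y \<in> carrier ?L"
      by (auto simp: carrier_localization ops) (metis S_mult m_closed)
  next
    show "\<one>\<^bsub>?L\<^esub> \<in> carrier ?L" by (auto simp: ops)
  next
    fix x y z assume "x \<in> carrier ?L" "y \<in> carrier ?L" "z \<in> carrier ?L"
    then show "x \<otimes>\<^bsub>?L\<^esub> y \<otimes>\<^bsub>?L\<^esub> z = x \<otimes>\<^bsub>?L\<^esub> (y \<otimes>\<^bsub>?L\<^esub> z)"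
      by (auto simp: carrier_localization ops m_assoc)
  next
    fix x assume "x \<in> carrier ?L"
    then show "\<one>\<^bsub>?L\<^esub> \<otimes>\<^bsub>?L\<^esub> x = x"
      by (auto simp: carrier_localization ops)
  next
    fix x y assume "x \<in> carrier ?L" "y \<in> carrier ?L"
    then show "x \<otimes>\<^bsub>?L\<^esub> y = y \<otimes>\<^bsub>?L\<^esub> x"
      by (auto simp: carrier_localization ops m_comm)
  qed
  fix x y z assume "x \<in> carrier ?L" "y \<in> carrier ?L" "z \<in> carrier ?L"
  then obtain a s b t c r where xyz: "x = loc_frac R S a s" "y = loc_frac R S b t" "z = loc_frac R S c r"
    and S: "s \<in> S" "t \<in> S" "r \<in> S" and C: "a \<in> carrier R" "b \<in> carrier R" "c \<in> carrier R"
    by (auto simp: carrier_localization)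
  have C': "s \<in> carrier R" "t \<in> carrier R" "r \<in> carrier R" using S by auto
  have "((a \<otimes> t \<oplus> b \<otimes> s) \<otimes> c) \<otimes> (s \<otimes> r \<otimes> (t \<otimes> r)) =
    (a \<otimes> c \<otimes> (t \<otimes> r) \<oplus> b \<otimes> c \<otimes> (s \<otimes> r)) \<otimes> (s \<otimes> t \<otimes> r)"
    using C C' by (simp add: distribs_ac)
  then show "(x \<oplus>\<^bsub>?L\<^esub> y) \<otimes>\<^bsub>?L\<^esub> z = x \<otimes>\<^bsub>?L\<^esub> z \<oplus>\<^bsub>?L\<^esub> y \<otimes>\<^bsub>?L\<^esub> z"
    using S C by (simp add: xyz ops) (rule loc_frac_eqI', simp+)
qed

end

context differential_ring
begin

lemma deriv_zero [simp]: "D \<zero> = \<zero>"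
  using deriv_add[of \<zero> \<zero>] by simp

lemma deriv_one [simp]: "D \<one> = \<zero>"
  using deriv_mult[of \<one> \<one>] by simp

lemma deriv_uminus: "a \<in> carrier R \<Longrightarrow> D (\<ominus> a) = \<ominus> D a"
  using deriv_add[of "\<ominus> a" a] by (simp add: l_neg minus_equality[symmetric])

lemma deriv_minus: "a \<in> carrier R \<Longrightarrow> b \<in> carrier R \<Longrightarrow> D (a \<ominus> b) = D a \<ominus> D b"
  by (simp add: minus_eq deriv_add deriv_uminus)

end

locale differential_ring_with_mult_set = differential_ring R D + ring_with_mult_set R S
  for R (structure) and D S
begin

lemma loc_deriv_frac:
  assumes "a \<in> carrier R" "s \<in> S"
  shows "loc_deriv R D S (loc_frac R S a s) = loc_frac R S (D a \<otimes> s \<ominus> a \<otimes> D s) (s \<otimes> s)"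
proof -
  have "(\<lambda>(a, s). loc_frac R S (D a \<otimes> s \<ominus> a \<otimes> D s) (s \<otimes> s)) respects loc_rel R S"
  proof (rule congruentI, clarify)
    fix a s b t assume "((a, s), (b, t)) \<in> loc_rel R S"
    then obtain u where u: "a \<in> carrier R" "s \<in> S" "b \<in> carrier R" "t \<in> S" "u \<in> S"
      "u \<otimes> (a \<otimes> t) = u \<otimes> (b \<otimes> s)"
      by (auto simp: loc_rel_iff)
    have c: "s \<in> carrier R" "t \<in> carrier R" "u \<in> carrier R"
      "D a \<in> carrier R" "D s \<in> carrier R" "D b \<in> carrier R" "D t \<in> carrier R" "D u \<in> carrier R"
      using u by auto
    have "D (u \<otimes> (a \<otimes> t)) = D (u \<otimes> (b \<otimes> s))"
      by (simp only: u(6))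
    then have "u \<otimes> (D u \<otimes> (a \<otimes> t) \<oplus> u \<otimes> (D a \<otimes> t \<oplus> a \<otimes> D t)) =
        u \<otimes> (D u \<otimes> (b \<otimes> s) \<oplus> u \<otimes> (D b \<otimes> s \<oplus> b \<otimes> D s))"
      using u(1,3) c by (simp add: deriv_mult)
    then have "D u \<otimes> (u \<otimes> (a \<otimes> t)) \<oplus> u \<otimes> (u \<otimes> (D a \<otimes> t \<oplus> a \<otimes> D t)) =
        D u \<otimes> (u \<otimes> (b \<otimes> s)) \<oplus> u \<otimes> (u \<otimes> (D b \<otimes> s \<oplus> b \<otimes> D s))"
      using u(1,3) c by (simp add: r_distr m_lcomm)
    then have d: "u \<otimes> (u \<otimes> (D a \<otimes> t \<oplus> a \<otimes> D t)) = u \<otimes> (u \<otimes> (D b \<otimes> s \<oplus> b \<otimes> D s))"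
      unfolding u(6) using u(1,3) c by simp
    have "u \<otimes> u \<otimes> (D a \<otimes> s \<otimes> (t \<otimes> t)) \<oplus> u \<otimes> u \<otimes> (b \<otimes> D t \<otimes> (s \<otimes> s)) =
        u \<otimes> u \<otimes> (D a \<otimes> s \<otimes> (t \<otimes> t)) \<oplus> u \<otimes> D t \<otimes> s \<otimes> (u \<otimes> (b \<otimes> s))"
      using u(1,3) c by (simp add: m_ac)
    also have "\<dots> = s \<otimes> t \<otimes> (u \<otimes> (u \<otimes> (D a \<otimes> t \<oplus> a \<otimes> D t)))"
      unfolding u(6)[symmetric] using u(1,3) c by (simp add: distribs_ac)
    also have "\<dots> = u \<otimes> u \<otimes> (D b \<otimes> t \<otimes> (s \<otimes> s)) \<oplus> u \<otimes> D s \<otimes> t \<otimes> (u \<otimes> (b \<otimes> s))"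
      unfolding d using u(1,3) c by (simp add: distribs_ac)
    also have "\<dots> = u \<otimes> u \<otimes> (D b \<otimes> t \<otimes> (s \<otimes> s)) \<oplus> u \<otimes> u \<otimes> (a \<otimes> D s \<otimes> (t \<otimes> t))"
      unfolding u(6)[symmetric] using u(1,3) c by (simp add: m_ac)
    finally have "(u \<otimes> u) \<otimes> ((D a \<otimes> s \<ominus> a \<otimes> D s) \<otimes> (t \<otimes> t)) =
        (u \<otimes> u) \<otimes> ((D b \<otimes> t \<ominus> b \<otimes> D t) \<otimes> (s \<otimes> s))"
      using u(1,3) c by (simp add: diff_distribs) (rule diff_eq_diffI, simp_all)
    then show "loc_frac R S (D a \<otimes> s \<ominus> a \<otimes> D s) (s \<otimes> s) = loc_frac R S (D b \<otimes> t \<ominus> b \<otimes> D t) (t \<otimes> t)"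
      using u by (intro loc_frac_eqI[where u = "u \<otimes> u"]) auto
  qed
  from UN_equiv_class[OF equiv_loc_rel this, of "(a, s)"] assms
  show ?thesis by (simp add: loc_deriv_def loc_frac_def case_prod_unfold)
qed

theorem differential_ring_localization:
  "differential_ring (localization R S) (loc_deriv R D S)"
proof -
  let ?L = "localization R S"
  note ops = mult_localization add_localization loc_deriv_frac
  interpret L: cring ?L by (rule cring_localization)
  show ?thesis
  proof
    fix x assume "x \<in> carrier ?L"
    then show "loc_deriv R D S x \<in> carrier ?L"
      by (auto simp: carrier_localization ops)
        (metis S_carrier S_mult deriv_closed m_closed minus_closed)
  next
    fix x y assume "x \<in> carrier ?L" "y \<in> carrier ?L"
    then obtain a s b t where xy: "x = loc_frac R S a s" "y = loc_frac R S b t"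
      and S: "s \<in> S" "t \<in> S" and C: "a \<in> carrier R" "b \<in> carrier R"
      by (auto simp: carrier_localization)
    have C': "s \<in> carrier R" "t \<in> carrier R"
      "D a \<in> carrier R" "D s \<in> carrier R" "D b \<in> carrier R" "D t \<in> carrier R"
      using S C by auto
    have "((D a \<otimes> t \<oplus> a \<otimes> D t \<oplus> (D b \<otimes> s \<oplus> b \<otimes> D s)) \<otimes> (s \<otimes> t)
          \<ominus> (a \<otimes> t \<oplus> b \<otimes> s) \<otimes> (D s \<otimes> t \<oplus> s \<otimes> D t)) \<otimes> (s \<otimes> s \<otimes> (t \<otimes> t)) =
        ((D a \<otimes> s \<ominus> a \<otimes> D s) \<otimes> (t \<otimes> t) \<oplus> (D b \<otimes> t \<ominus> b \<otimes> D t) \<otimes> (s \<otimes> s)) \<otimes>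
        (s \<otimes> t \<otimes> (s \<otimes> t))"
      using C C' by (simp add: diff_distribs diff_add_diff) (rule diff_eq_diffI, simp_all add: distribs_ac)
    then show "loc_deriv R D S (x \<oplus>\<^bsub>?L\<^esub> y) = loc_deriv R D S x \<oplus>\<^bsub>?L\<^esub> loc_deriv R D S y"
      using S C by (simp add: xy ops deriv_add deriv_mult) (rule loc_frac_eqI', simp+)
    have "((D a \<otimes> b \<oplus> a \<otimes> D b) \<otimes> (s \<otimes> t) \<ominus> (a \<otimes> b) \<otimes> (D s \<otimes> t \<oplus> s \<otimes> D t)) \<otimes>
          (s \<otimes> s \<otimes> t \<otimes> (s \<otimes> (t \<otimes> t))) =
        ((D a \<otimes> s \<ominus> a \<otimes> D s) \<otimes> b \<otimes> (s \<otimes> (t \<otimes> t)) \<oplus> a \<otimes> (D b \<otimes> t \<ominus> b \<otimes> D t) \<otimes> (s \<otimes> s \<otimes> t)) \<otimes>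
        (s \<otimes> t \<otimes> (s \<otimes> t))"
      using C C' by (simp add: diff_distribs diff_add_diff) (rule diff_eq_diffI, simp_all add: distribs_ac)
    then show "loc_deriv R D S (x \<otimes>\<^bsub>?L\<^esub> y) =
        loc_deriv R D S x \<otimes>\<^bsub>?L\<^esub> y \<oplus>\<^bsub>?L\<^esub> x \<otimes>\<^bsub>?L\<^esub> loc_deriv R D S y"
      using S C by (simp add: xy ops deriv_add deriv_mult) (rule loc_frac_eqI', simp+)
  qed
qed

lemma loc_deriv_extends:
  assumes "a \<in> carrier R"
  shows "loc_deriv R D S (loc_frac R S a \<one>) = loc_frac R S (D a) \<one>"
  using assms by (simp add: loc_deriv_frac minus_eq)

theorem loc_deriv_unique:
  assumes E: "differential_ring (localization R S) E"
    and ext: "\<And>a. a \<in> carrier R \<Longrightarrow> E (loc_frac R S a \<one>) = loc_frac R S (D a) \<one>"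
    and x: "x \<in> carrier (localization R S)"
  shows "E x = loc_deriv R D S x"
proof -
  let ?L = "localization R S"
  interpret L: differential_ring ?L E by (rule E)
  interpret M: differential_ring ?L "loc_deriv R D S" by (rule differential_ring_localization)
  obtain a s where x: "x = loc_frac R S a s" and S: "s \<in> S" and C: "a \<in> carrier R"
    using x by (auto simp: carrier_localization)
  let ?s = "loc_frac R S s \<one>" and ?i = "loc_frac R S \<one> s"
  have cl: "x \<in> carrier ?L" "?s \<in> carrier ?L" "?i \<in> carrier ?L" using S C x by auto
  have xs: "x \<otimes>\<^bsub>?L\<^esub> ?s = loc_frac R S a \<one>"
    using S C by (simp add: x mult_localization) (rule loc_frac_eqI', auto)
  have i: "?s \<otimes>\<^bsub>?L\<^esub> ?i = \<one>\<^bsub>?L\<^esub>"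
    using S C by (simp add: mult_localization one_localization) (rule loc_frac_eqI', auto)
  have "E (x \<otimes>\<^bsub>?L\<^esub> ?s) = loc_deriv R D S (x \<otimes>\<^bsub>?L\<^esub> ?s)"
    using C by (simp add: xs ext loc_deriv_extends)
  moreover have "E ?s = loc_deriv R D S ?s"
    using S by (simp add: ext loc_deriv_extends)
  ultimately have "E x \<otimes>\<^bsub>?L\<^esub> ?s = loc_deriv R D S x \<otimes>\<^bsub>?L\<^esub> ?s"
    using cl by (simp add: L.deriv_mult M.deriv_mult)
  then have "E x \<otimes>\<^bsub>?L\<^esub> ?s \<otimes>\<^bsub>?L\<^esub> ?i = loc_deriv R D S x \<otimes>\<^bsub>?L\<^esub> ?s \<otimes>\<^bsub>?L\<^esub> ?i"
    by simp
  then show ?thesis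
    using cl by (simp add: L.m_assoc i)
qed

end

end

theory Submission
  imports Defs
begin

text \<open>
  Write \<open>M(i,j)\<close> for the \<open>2 \<times> 2\<close> minor \<open>a\<^sub>i b\<^sub>j - a\<^sub>j b\<^sub>i\<close>, where the index counts derivatives. The
  hypothesis is \<open>\<theta> M(1,0) = 0\<close>, and the conclusions say that other minors are killed by suitable
  monomials in \<open>b\<close> and \<open>\<theta>\<close>. Three facts carry the proof.

  \<^item> Differentiation moves along the minors: \<open>M(i,j)' = M(i+1,j) + M(i,j+1)\<close>
    (\<open>deriv_jet_minor\<close>).

  \<^item> A Pluecker relation expresses \<open>b M(i,j)\<close> by minors that involve the index \<open>0\<close>:
    \<open>b M(i,j) = b\<^sub>j M(i,0) - b\<^sub>i M(j,0)\<close> (\<open>jet_minor_plucker\<close>).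

  \<^item> An equation \<open>x u = 0\<close> can be differentiated at the cost of one factor \<open>c\<close>, namely to
    \<open>c x u' = 0\<close>, as soon as \<open>x\<close> divides \<open>c x'\<close> (\<open>annihilates_deriv\<close>). This is the case for
    \<open>x = (b \<theta>)\<^sup>n \<theta>\<close> and \<open>c = b \<theta>\<close> (\<open>mult_deriv_pow_mult\<close>).

  Together they give \<open>(b \<theta>)\<^sup>n \<theta> M(n+1,0) = 0\<close> by induction on \<open>n\<close>: the derivative of this equation
  yields \<open>(b \<theta>)\<^sup>n\<^sup>+\<^sup>1 \<theta> (M(n+2,0) + M(n+1,1)) = 0\<close>, and the factor \<open>b\<close> gained on the way turns the
  second term, by the Pluecker relation, into multiples of the known equations for \<open>M(n+1,0)\<close> and
  \<open>M(1,0)\<close>. One more use of the relation reaches all \<open>M(i,j)\<close> with \<open>i + j = N\<close>. For \<open>n = 0\<close> the term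
  \<open>M(1,1)\<close> vanishes outright, so that \<open>\<theta>\<^sup>2 M(2,0) = 0\<close> holds without any factor \<open>b\<close>.

  For fractions, \<open>(a/s)' = 0\<close> means that some \<open>u \<in> S\<close> kills \<open>M(1,0)\<close> formed with \<open>b = s\<close>. Then the
  element \<open>(s u)\<^sup>i u\<close>, which lies in \<open>S\<close>, kills \<open>M(i,0)\<close>, and this is the equality
  \<open>a/s = a\<^sub>i/s\<^sub>i\<close>.
\<close>

section \<open>Minors of iterated derivatives\<close>

context differential_ring
begin

lemma iter_deriv_closed [simp, intro]: "a \<in> carrier R \<Longrightarrow> (D ^^ n) a \<in> carrier R"
  by (induction n) auto

definition jet_minor :: "'a \<Rightarrow> 'a \<Rightarrow> nat \<Rightarrow> nat \<Rightarrow> 'a" where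
  "jet_minor a b i j = (D ^^ i) a \<otimes> (D ^^ j) b \<ominus> (D ^^ j) a \<otimes> (D ^^ i) b"

lemma jet_minor_closed [simp, intro]:
  "a \<in> carrier R \<Longrightarrow> b \<in> carrier R \<Longrightarrow> jet_minor a b i j \<in> carrier R"
  by (simp add: jet_minor_def)

lemma jet_minor_self [simp]:
  "a \<in> carrier R \<Longrightarrow> b \<in> carrier R \<Longrightarrow> jet_minor a b i i = \<zero>"
  by (simp add: jet_minor_def minus_eq r_neg)

lemma jet_minor_swap:
  assumes "a \<in> carrier R" "b \<in> carrier R"
  shows "jet_minor a b j i = \<ominus> jet_minor a b i j"
proof -
  have "(D ^^ i) a \<in> carrier R" "(D ^^ j) a \<in> carrier R"
    "(D ^^ i) b \<in> carrier R" "(D ^^ j) b \<in> carrier R"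
    using assms by auto
  then show ?thesis unfolding jet_minor_def by algebra
qed

lemma deriv_jet_minor:
  assumes "a \<in> carrier R" "b \<in> carrier R"
  shows "D (jet_minor a b i j) = jet_minor a b (Suc i) j \<oplus> jet_minor a b i (Suc j)"
proof -
  have c: "(D ^^ i) a \<in> carrier R" "(D ^^ j) a \<in> carrier R"
    "(D ^^ i) b \<in> carrier R" "(D ^^ j) b \<in> carrier R"
    "D ((D ^^ i) a) \<in> carrier R" "D ((D ^^ j) a) \<in> carrier R"
    "D ((D ^^ i) b) \<in> carrier R" "D ((D ^^ j) b) \<in> carrier R"
    using assms by auto
  have "D (jet_minor a b i j) =
      (D ((D ^^ i) a) \<otimes> (D ^^ j) b \<oplus> (D ^^ i) a \<otimes> D ((D ^^ j) b)) \<ominus>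
      (D ((D ^^ j) a) \<otimes> (D ^^ i) b \<oplus> (D ^^ j) a \<otimes> D ((D ^^ i) b))"
    using c by (simp add: jet_minor_def deriv_minus deriv_mult)
  also have "\<dots> = jet_minor a b (Suc i) j \<oplus> jet_minor a b i (Suc j)"
    unfolding jet_minor_def funpow.simps comp_apply using c by algebra
  finally show ?thesis .
qed

text \<open>
  Expanding the right-hand side, the monomial \<open>a b\<^sub>i b\<^sub>j\<close> occurs with both signs and cancels.
\<close>

lemma jet_minor_plucker:
  assumes "a \<in> carrier R" "b \<in> carrier R"
  shows "b \<otimes> jet_minor a b i j =
    (D ^^ j) b \<otimes> jet_minor a b i 0 \<ominus> (D ^^ i) b \<otimes> jet_minor a b j 0"
proof -
  have c: "(D ^^ i) a \<in> carrier R" "(D ^^ j) a \<in> carrier R"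
    "(D ^^ i) b \<in> carrier R" "(D ^^ j) b \<in> carrier R"
    using assms by auto
  with assms show ?thesis unfolding jet_minor_def funpow_0 by algebra
qed

section \<open>Annihilators of the minors\<close>

text \<open>
  The product rule gives \<open>0 = c (x u)' = (c x') u + c x u'\<close>, and \<open>(c x') u\<close> is a multiple of
  \<open>x u = 0\<close>. Since \<open>e\<close> is left open, no formula for the derivative of a power is needed when \<open>x\<close>
  is one.
\<close>

lemma annihilates_deriv:
  assumes x: "x \<otimes> u = \<zero>" and e: "c \<otimes> D x = x \<otimes> e"
    and [simp]: "c \<in> carrier R" "x \<in> carrier R" "u \<in> carrier R" "e \<in> carrier R"
  shows "(c \<otimes> x) \<otimes> D u = \<zero>"
proof -
  have "(c \<otimes> D x) \<otimes> u = (x \<otimes> u) \<otimes> e" by (simp add: e m_ac)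
  then have 0: "(c \<otimes> D x) \<otimes> u = \<zero>" by (simp add: x)
  have "\<zero> = c \<otimes> D (x \<otimes> u)" by (simp add: x)
  also have "\<dots> = (c \<otimes> D x) \<otimes> u \<oplus> (c \<otimes> x) \<otimes> D u" by (simp add: deriv_mult r_distr m_assoc)
  finally show ?thesis by (simp add: 0)
qed

text \<open>
  Logarithmic derivatives add up under products, so the multiples \<open>e\<close> do as well: the factor
  \<open>\<theta>\<close> contributes \<open>b \<theta>'\<close>, since \<open>b \<theta> \<theta>' = \<theta> (b \<theta>')\<close>, and every factor \<open>b \<theta>\<close> contributes
  \<open>(b \<theta>)'\<close>.
\<close>

lemma mult_deriv_pow_mult:
  assumes [simp]: "b \<in> carrier R" "\<theta> \<in> carrier R"
  shows "\<exists>e\<in>carrier R. (b \<otimes> \<theta>) \<otimes> D ((b \<otimes> \<theta>) [^] (n::nat) \<otimes> \<theta>) = ((b \<otimes> \<theta>) [^] n \<otimes> \<theta>) \<otimes> e"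
proof (induction n)
  case 0
  show ?case by (rule bexI[of _ "b \<otimes> D \<theta>"]) (simp_all add: m_ac)
next
  case (Suc n)
  let ?c = "b \<otimes> \<theta>" and ?x = "(b \<otimes> \<theta>) [^] n \<otimes> \<theta>"
  obtain e where e: "e \<in> carrier R" "?c \<otimes> D ?x = ?x \<otimes> e" using Suc by blast
  have cl: "?c \<in> carrier R" "?x \<in> carrier R" "D ?c \<in> carrier R" "D ?x \<in> carrier R" by simp_all
  have S: "?c [^] Suc n \<otimes> \<theta> = ?c \<otimes> ?x" by (simp add: m_ac)
  have "?c \<otimes> D (?c \<otimes> ?x) = ?c \<otimes> ?x \<otimes> D ?c \<oplus> ?c \<otimes> (?c \<otimes> D ?x)"
    unfolding deriv_mult[OF cl(1,2)] using cl by algebra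
  also have "\<dots> = ?c \<otimes> ?x \<otimes> (D ?c \<oplus> e)"
    unfolding e(2) using cl e(1) by algebra
  finally have "?c \<otimes> D (?c \<otimes> ?x) = ?c \<otimes> ?x \<otimes> (D ?c \<oplus> e)" .
  then show ?case unfolding S using cl e(1) by blast
qed

lemma annihilates_jet_minor_2:
  assumes [simp]: "a \<in> carrier R" "b \<in> carrier R" "\<theta> \<in> carrier R"
    and W: "\<theta> \<otimes> jet_minor a b 1 0 = \<zero>"
  shows "\<theta> [^] (2::nat) \<otimes> jet_minor a b 2 0 = \<zero>"
  \<comment> \<open>Here \<open>x = c = \<theta>\<close>, and the derivative of \<open>M(1,0)\<close> is \<open>M(2,0) + M(1,1)\<close> with \<open>M(1,1) = 0\<close>.\<close>
  using annihilates_deriv[OF W, of \<theta> "D \<theta>"]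
  by (simp add: deriv_jet_minor numeral_2_eq_2)

text \<open>
  The extra \<open>\<theta>\<close> beside \<open>(b \<theta>)\<^sup>n\<close> makes the case \<open>n = 0\<close> the hypothesis itself.
\<close>

lemma annihilates_jet_minor_0:
  assumes [simp]: "a \<in> carrier R" "b \<in> carrier R" "\<theta> \<in> carrier R"
    and W: "\<theta> \<otimes> jet_minor a b 1 0 = \<zero>"
  shows "((b \<otimes> \<theta>) [^] n \<otimes> \<theta>) \<otimes> jet_minor a b (Suc n) 0 = \<zero>"
proof (induction n)
  case 0
  then show ?case using W by simp
next
  case (Suc n)
  let ?c = "b \<otimes> \<theta>" and ?p = "(b \<otimes> \<theta>) [^] n" and ?x = "(b \<otimes> \<theta>) [^] n \<otimes> \<theta>" and ?M = "jet_minor a b"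
  let ?b = "(D ^^ Suc n) b"
  have b: "?b \<in> carrier R" by (rule iter_deriv_closed) simp
  obtain e where e: "e \<in> carrier R" "?c \<otimes> D ?x = ?x \<otimes> e"
    using mult_deriv_pow_mult[of b \<theta> n] by auto
  have "(?c \<otimes> ?x) \<otimes> D (?M (Suc n) 0) = \<zero>"
    by (rule annihilates_deriv[OF Suc e(2)]) (simp_all add: e(1))
  then have sum: "(?c \<otimes> ?x) \<otimes> ?M (Suc (Suc n)) 0 \<oplus> (?c \<otimes> ?x) \<otimes> ?M (Suc n) 1 = \<zero>"
    by (simp add: deriv_jet_minor r_distr)
  \<comment> \<open>The factor \<open>b\<close> of \<open>c\<close> pays for the Pluecker relation; its factor \<open>\<theta>\<close> is left over.\<close>
  have "(?c \<otimes> ?x) \<otimes> ?M (Suc n) 1 = \<theta> \<otimes> ?x \<otimes> (b \<otimes> ?M (Suc n) 1)"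
    by (simp add: m_ac)
  also have "\<dots> = \<theta> \<otimes> ?x \<otimes> (D b \<otimes> ?M (Suc n) 0 \<ominus> ?b \<otimes> ?M 1 0)"
    by (subst jet_minor_plucker) simp_all
  also have "\<dots> = \<theta> \<otimes> D b \<otimes> (?x \<otimes> ?M (Suc n) 0) \<ominus> \<theta> \<otimes> ?p \<otimes> ?b \<otimes> (\<theta> \<otimes> ?M 1 0)"
  proof -
    have "?p \<in> carrier R" "?M (Suc n) 0 \<in> carrier R" "?M 1 0 \<in> carrier R" "D b \<in> carrier R"
      by simp_all
    with b assms(3) show ?thesis by algebra
  qed
  also have "\<dots> = \<zero>"
    unfolding Suc W using b by (simp add: minus_eq del: funpow.simps)
  finally show ?case
    using sum by (simp add: m_ac)
qed

text \<open>
  The Pluecker relation brings in two minors of different orders at once, so it needs one element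
  that annihilates both.
\<close>

lemma annihilates_jet_minor_0_le:
  assumes [simp]: "a \<in> carrier R" "b \<in> carrier R" "\<theta> \<in> carrier R"
    and W: "\<theta> \<otimes> jet_minor a b 1 0 = \<zero>" and "n \<le> Suc m"
  shows "((b \<otimes> \<theta>) [^] m \<otimes> \<theta>) \<otimes> jet_minor a b n 0 = \<zero>"
proof (cases n)
  case 0
  then show ?thesis by simp
next
  case (Suc k)
  then obtain d where m: "m = d + k" using \<open>n \<le> Suc m\<close> by (metis Suc_le_mono le_add_diff_inverse2)
  have "((b \<otimes> \<theta>) [^] m \<otimes> \<theta>) \<otimes> jet_minor a b n 0 =
      (b \<otimes> \<theta>) [^] d \<otimes> (((b \<otimes> \<theta>) [^] k \<otimes> \<theta>) \<otimes> jet_minor a b (Suc k) 0)"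
    unfolding m Suc nat_pow_mult[symmetric, OF m_closed[OF assms(2,3)]]
    by (simp add: m_assoc)
  also have "\<dots> = \<zero>" by (simp add: annihilates_jet_minor_0[OF assms(1-3) W])
  finally show ?thesis .
qed

text \<open>
  If \<open>i\<close> and \<open>j\<close> are both positive, they are at most \<open>m\<close>, and \<open>(b \<theta>)\<^sup>m\<^sup>-\<^sup>1 \<theta>\<close> already kills
  \<open>M(i,0)\<close> and \<open>M(j,0)\<close>; the remaining factor \<open>b\<close> is spent on the Pluecker relation. If one index
  is \<open>0\<close>, the other is \<open>m + 1\<close>, and the full annihilator is used without that relation.
\<close>

lemma annihilates_jet_minor:
  assumes [simp]: "a \<in> carrier R" "b \<in> carrier R" "\<theta> \<in> carrier R"
    and W: "\<theta> \<otimes> jet_minor a b 1 0 = \<zero>" and ij: "i + j = Suc m"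
  shows "((b \<otimes> \<theta>) [^] m \<otimes> \<theta>) \<otimes> jet_minor a b i j = \<zero>"
proof -
  note low = annihilates_jet_minor_0_le[OF assms(1-3) W]
  consider "j = 0" | "i = 0" | k where "m = Suc k" "i \<le> Suc k" "j \<le> Suc k"
    using ij by (cases i; cases j; cases m) auto
  then show ?thesis
  proof cases
    case 1
    then show ?thesis using low[of i m] ij by simp
  next
    case 2
    then have "((b \<otimes> \<theta>) [^] m \<otimes> \<theta>) \<otimes> jet_minor a b j i = \<zero>" using low[of j m] ij by simp
    then show ?thesis by (subst jet_minor_swap) (simp_all add: r_minus)
  next
    case (3 k)
    let ?x = "(b \<otimes> \<theta>) [^] k \<otimes> \<theta>" and ?M = "jet_minor a b"
    let ?bi = "(D ^^ i) b" and ?bj = "(D ^^ j) b"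
    have "((b \<otimes> \<theta>) [^] m \<otimes> \<theta>) \<otimes> ?M i j = \<theta> \<otimes> ?x \<otimes> (b \<otimes> ?M i j)"
      by (simp add: 3 m_ac)
    also have "\<dots> = \<theta> \<otimes> ?x \<otimes> (?bj \<otimes> ?M i 0 \<ominus> ?bi \<otimes> ?M j 0)"
      by (subst jet_minor_plucker) simp_all
    also have "\<dots> = \<theta> \<otimes> ?bj \<otimes> (?x \<otimes> ?M i 0) \<ominus> \<theta> \<otimes> ?bi \<otimes> (?x \<otimes> ?M j 0)"
    proof -
      have "?x \<in> carrier R" "?M i 0 \<in> carrier R" "?M j 0 \<in> carrier R"
        "?bi \<in> carrier R" "?bj \<in> carrier R" by simp_all
      with assms(3) show ?thesis by algebra
    qed
    also have "\<dots> = \<zero>" by (simp add: low 3 minus_eq)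
    finally show ?thesis .
  qed
qed

end

section \<open>Fractions with zero derivative\<close>

context differential_ring_with_mult_set
begin

lemma loc_deriv_frac_eq_zero_iff:
  assumes "a \<in> carrier R" "s \<in> S"
  shows "loc_deriv R D S (loc_frac R S a s) = \<zero>\<^bsub>localization R S\<^esub> \<longleftrightarrow>
    (\<exists>u\<in>S. u \<otimes> jet_minor a s 1 0 = \<zero>)"
proof -
  have "D a \<otimes> s \<ominus> a \<otimes> D s \<in> carrier R" using assms by auto
  then show ?thesis
    using assms by (simp add: loc_deriv_frac zero_localization loc_frac_eq_iff jet_minor_def)
qed

lemma loc_frac_eq_iter_deriv:
  assumes "a \<in> carrier R" "s \<in> S"
    and "loc_deriv R D S (loc_frac R S a s) = \<zero>\<^bsub>localization R S\<^esub>" and "(D ^^ i) s \<in> S"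
  shows "loc_frac R S a s = loc_frac R S ((D ^^ i) a) ((D ^^ i) s)"
proof -
  obtain u where u: "u \<in> S" "u \<otimes> jet_minor a s 1 0 = \<zero>"
    using assms loc_deriv_frac_eq_zero_iff by auto
  let ?v = "(s \<otimes> u) [^] i \<otimes> u"
  have "(s \<otimes> u) [^] n \<in> S" for n :: nat
    using u assms by (induction n) simp_all
  then have v: "?v \<in> S" using u by simp
  have "?v \<otimes> jet_minor a s i 0 = \<zero>"
    using annihilates_jet_minor_0_le[of a s u i i] u assms by simp
  then have "?v \<otimes> ((D ^^ i) a \<otimes> s) = ?v \<otimes> (a \<otimes> (D ^^ i) s)"
    using v assms by (simp add: jet_minor_def mult_diff_zero_iff)
  then show ?thesis
    using v assms by (intro loc_frac_eqI[where u = ?v]) auto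
qed

end

theorem proposition4p2:
  fixes A (structure) and D :: "'a \<Rightarrow> 'a"
  assumes "differential_ring A D"
  shows
    "(\<forall>\<theta>\<in>carrier A. \<forall>a\<in>carrier A. \<forall>b\<in>carrier A.
        \<theta> \<otimes> (D a \<otimes> b \<ominus> a \<otimes> D b) = \<zero> \<longrightarrow>
        (\<forall>N i :: nat. 3 \<le> N \<and> i \<le> N \<longrightarrow>
           \<theta> \<otimes> (D a \<otimes> b \<ominus> a \<otimes> D b) = \<zero> \<and>
           \<theta> [^] (2::nat) \<otimes> ((D ^^ 2) a \<otimes> b \<ominus> a \<otimes> (D ^^ 2) b) = \<zero> \<and>
           b [^] (N - 1) \<otimes> \<theta> [^] N \<otimes>
             ((D ^^ i) b \<otimes> (D ^^ (N - i)) a \<ominus> (D ^^ i) a \<otimes> (D ^^ (N - i)) b) = \<zero>)) \<and>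
     (\<forall>S a s. \<forall>i :: nat.
        submonoid S A \<and> a \<in> carrier A \<and> s \<in> S \<and>
        loc_deriv A D S (loc_frac A S a s) = \<zero>\<^bsub>localization A S\<^esub> \<and> (D ^^ i) s \<in> S \<longrightarrow>
        loc_frac A S a s = loc_frac A S ((D ^^ i) a) ((D ^^ i) s))"
proof -
  interpret differential_ring A D by (rule assms)
  show ?thesis
  proof (intro conjI ballI allI impI; (elim conjE)?)
    fix \<theta> a b and N i :: nat
    assume cl [simp]: "\<theta> \<in> carrier A" "a \<in> carrier A" "b \<in> carrier A"
      and W: "\<theta> \<otimes> (D a \<otimes> b \<ominus> a \<otimes> D b) = \<zero>"
    from W have W': "\<theta> \<otimes> jet_minor a b 1 0 = \<zero>" by (simp add: jet_minor_def)
    show "\<theta> \<otimes> (D a \<otimes> b \<ominus> a \<otimes> D b) = \<zero>" by (rule W)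
    show "\<theta> [^] (2::nat) \<otimes> ((D ^^ 2) a \<otimes> b \<ominus> a \<otimes> (D ^^ 2) b) = \<zero>"
      using annihilates_jet_minor_2[OF cl(2,3,1) W'] by (simp add: jet_minor_def)
    assume N: "3 \<le> N" "i \<le> N"
    then obtain m where m: "N = Suc m" by (cases N) auto
    \<comment> \<open>For \<open>N = m + 1\<close> the required monomial \<open>b\<^sup>N\<^sup>-\<^sup>1 \<theta>\<^sup>N\<close> is \<open>(b \<theta>)\<^sup>m \<theta>\<close>.\<close>
    have "(b \<otimes> \<theta>) [^] m \<otimes> \<theta> = b [^] (N - 1) \<otimes> \<theta> [^] N"
      by (simp add: m nat_pow_distrib m_assoc)
    moreover have "jet_minor a b (N - i) i =
        (D ^^ i) b \<otimes> (D ^^ (N - i)) a \<ominus> (D ^^ i) a \<otimes> (D ^^ (N - i)) b"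
      by (simp add: jet_minor_def m_comm)
    ultimately show "b [^] (N - 1) \<otimes> \<theta> [^] N \<otimes>
        ((D ^^ i) b \<otimes> (D ^^ (N - i)) a \<ominus> (D ^^ i) a \<otimes> (D ^^ (N - i)) b) = \<zero>"
      using annihilates_jet_minor[OF cl(2,3,1) W', of "N - i" i m] N m by simp
  next
    fix S a s and i :: nat
    assume S: "submonoid S A" and hyps: "a \<in> carrier A" "s \<in> S"
      "loc_deriv A D S (loc_frac A S a s) = \<zero>\<^bsub>localization A S\<^esub>" "(D ^^ i) s \<in> S"
    interpret differential_ring_with_mult_set A D S
      using S by (intro differential_ring_with_mult_set.intro ring_with_mult_set.intro
        ring_with_mult_set_axioms.intro differential_ring_axioms cring_axioms)
    show "loc_frac A S a s = loc_frac A S ((D ^^ i) a) ((D ^^ i) s)"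
      by (rule loc_frac_eq_iter_deriv[OF hyps])
  qed
qed

end
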